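(* Let $\alpha=(\alpha_n)_{n\in\mathbb{N}}$ be a non-negative increasing sequence with $\lim_{n\to\infty}\alpha_n=\infty$ such that $\Lambda_\infty(\alpha)$ is nuclear, and let $\beta\in(\Lambda_\infty(\alpha))'$. Then the dual convolution operator $\check{T}_\beta:\Lambda_\infty(\alpha)\to\Lambda_\infty(\alpha)$ is topologizable if and only if for every $p\in\mathbb{N}$ there exists $q\in\mathbb{N}$ such that for every $k\in\mathbb{N}$ there is $L_{k,p}>0$ with $$|\beta^{*k}_{n-1}|\le L_{k,p}\,e^{q\alpha_n}\quad\text{for every } n\in\mathbb{N}.$$
   Context: $\mathbb{N}=\{1,2,\dots\}$, $\mathbb{N}_0=\mathbb{N}\cup\{0\}$. The power series space of infinite type is $\Lambda_\infty(\alpha)=\{x=(x_n)_{n\in\mathbb{N}}:\|x\|_k:=\sum_{n=1}^\infty|x_n|e^{k\alpha_n}<\infty\text{ for all }k\in\mathbb{N}\}$, a Fréchet space with the increasing sequence of seminorms $(\|\cdot\|_k)_{k\in\mathbb{N}}$ and canonical basis $(e_n)_{n\in\mathbb{N}}$. It is nuclear if and only if $\sup_{n}\frac{\ln n}{\alpha_n}<\infty$. Its dual is identified with the sequences $\beta=(\beta_n)_{n\in\mathbb{N}_0}$ (indexed from $0$, $\beta_{n-1}$ being the $n$-th coordinate) such that for some $m\in\mathbb{N}$, $C>0$: $|\beta_{n-1}|\le Ce^{m\alpha_n}$ for all $n\in\mathbb{N}$. The dual convolution operator $\check{T}_\beta$ is the continuous linear operator on $\Lambda_\infty(\alpha)$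 with $\check{T}_\beta e_n=\sum_{j=1}^n\beta_{n-j}e_j$ and $\check{T}_\beta x=\sum_{n=1}^\infty x_n\check{T}_\beta e_n$ (well-defined and continuous for every $\beta\in(\Lambda_\infty(\alpha))'$ when $\Lambda_\infty(\alpha)$ is nuclear). Convolution of sequences indexed by $\mathbb{N}_0$: $(\beta*\psi)_m=\sum_{i=0}^m\beta_i\psi_{m-i}$; $\beta^{*k}=\beta*\cdots*\beta$ ($k$ factors), and $\beta^{*k}_{m}$ is its entry of index $m\in\mathbb{N}_0$. A continuous linear operator $T$ on a Fréchet space $E$ with increasing seminorms $(\|\cdot\|_p)_{p\in\mathbb{N}}$ is topologizable if for every $p\in\mathbb{N}$ there is $q\in\mathbb{N}$ such that for every $k\in\mathbb{N}$ there is $M_{k,p}>0$ with $\|T^kx\|_p\le M_{k,p}\|x\|_q$ for all $x\in E$. *)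

theory Defs
  imports Complex_Main
begin

text \<open>
  The scalar field is a complete real normed field, i.e. (up to isometric isomorphism)
  \<open>\<real>\<close> or \<open>\<complex>\<close>; linearity is always with respect to that field.

  Elements of the sequence space, the exponent sequence \<open>\<alpha>\<close> and the basis vectors are indexed
  from 0 instead of 1: \<open>x n\<close>, \<open>\<alpha> n\<close>, \<open>unit_seq n\<close> stand for $x_{n+1}$, $\alpha_{n+1}$, $e_{n+1}$.
  The elements of the dual are indexed from 0 in the mathematical text already, so that
  \<open>\<beta> n\<close> is the coordinate paired with \<open>x n\<close>.
  Indices of seminorms and iterates still range over the positive integers.
\<close>

subsection \<open>Sequence spaces with an increasing system of seminorms\<close>

text \<open>A space is a set \<open>E\<close> of sequences with seminorms \<open>P 1 \<le> P 2 \<le> \<dots>\<close> on it (\<open>P 0\<close> is not used).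
  As the system is increasing, the sets \<open>{y \<in> E. P q (y - x) < d}\<close> form a neighbourhood base at \<open>x\<close>.\<close>

definition linear_functional_on ::
    "(nat \<Rightarrow> 'a::{real_normed_field,banach}) set \<Rightarrow> ((nat \<Rightarrow> 'a) \<Rightarrow> 'a) \<Rightarrow> bool" where
  "linear_functional_on E f \<longleftrightarrow>
     (\<forall>x\<in>E. \<forall>y\<in>E. f (\<lambda>n. x n + y n) = f x + f y) \<and>
     (\<forall>c. \<forall>x\<in>E. f (\<lambda>n. c * x n) = c * f x)"

definition linear_operator_on ::
    "(nat \<Rightarrow> 'a::{real_normed_field,banach}) set \<Rightarrow> ((nat \<Rightarrow> 'a) \<Rightarrow> (nat \<Rightarrow> 'a)) \<Rightarrow> bool" where
  "linear_operator_on E T \<longleftrightarrow>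
     (\<forall>x\<in>E. T x \<in> E) \<and>
     (\<forall>x\<in>E. \<forall>y\<in>E. T (\<lambda>n. x n + y n) = (\<lambda>n. T x n + T y n)) \<and>
     (\<forall>c. \<forall>x\<in>E. T (\<lambda>n. c * x n) = (\<lambda>n. c * T x n))"

definition continuous_operator_on ::
    "(nat \<Rightarrow> 'a::{real_normed_field,banach}) set \<Rightarrow> (nat \<Rightarrow> (nat \<Rightarrow> 'a) \<Rightarrow> real)
      \<Rightarrow> ((nat \<Rightarrow> 'a) \<Rightarrow> (nat \<Rightarrow> 'a)) \<Rightarrow> bool" where
  "continuous_operator_on E P T \<longleftrightarrow>
     (\<forall>x\<in>E. \<forall>p\<ge>1. \<forall>\<epsilon>>0. \<exists>q\<ge>1. \<exists>d>0. \<forall>y\<in>E.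
        P q (\<lambda>n. y n - x n) < d \<longrightarrow> P p (\<lambda>n. T y n - T x n) < \<epsilon>)"

definition topologizable_on ::
    "(nat \<Rightarrow> 'a::{real_normed_field,banach}) set \<Rightarrow> (nat \<Rightarrow> (nat \<Rightarrow> 'a) \<Rightarrow> real)
      \<Rightarrow> ((nat \<Rightarrow> 'a) \<Rightarrow> (nat \<Rightarrow> 'a)) \<Rightarrow> bool" where
  "topologizable_on E P T \<longleftrightarrow>
     linear_operator_on E T \<and> continuous_operator_on E P T \<and>
     (\<forall>p\<ge>1. \<exists>q\<ge>1. \<forall>k\<ge>1. \<exists>M>0. \<forall>x\<in>E. P p ((T ^^ k) x) \<le> M * P q x)"

text \<open>Nuclearity: for every \<open>p\<close> there is \<open>q \<ge> p\<close> such that the canonical map \<open>E\<^sub>q \<rightarrow> E\<^sub>p\<close> between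
  the local Banach spaces (completions of \<open>E\<close> modulo the kernels of \<open>P q\<close> and \<open>P p\<close>) is a nuclear
  operator, that is \<open>x \<mapsto> \<Sum>\<^sub>j f\<^sub>j(x) y\<^sub>j\<close> with \<open>\<Sum>\<^sub>j \<parallel>f\<^sub>j\<parallel> \<parallel>y\<^sub>j\<parallel> < \<infinity>\<close>.
  The functionals on \<open>E\<^sub>q\<close> are the \<open>P q\<close>-bounded linear functionals on \<open>E\<close>. As \<open>E\<close> is dense in
  \<open>E\<^sub>p\<close>, the \<open>y\<^sub>j\<close> can be taken in \<open>E\<close>: any element of \<open>E\<^sub>p\<close> is an absolutely convergent series
  of elements of \<open>E\<close> whose norms add up to at most twice its own norm. It suffices to require
  the representation on the dense subspace \<open>E\<close> of \<open>E\<^sub>q\<close>.\<close>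

definition nuclear_on ::
    "(nat \<Rightarrow> 'a::{real_normed_field,banach}) set \<Rightarrow> (nat \<Rightarrow> (nat \<Rightarrow> 'a) \<Rightarrow> real) \<Rightarrow> bool" where
  "nuclear_on E P \<longleftrightarrow>
     (\<forall>p\<ge>1. \<exists>q\<ge>p. \<exists>(f :: nat \<Rightarrow> (nat \<Rightarrow> 'a) \<Rightarrow> 'a) (c :: nat \<Rightarrow> real) (y :: nat \<Rightarrow> nat \<Rightarrow> 'a).
        (\<forall>j. linear_functional_on E (f j) \<and> 0 \<le> c j \<and> (\<forall>x\<in>E. norm (f j x) \<le> c j * P q x)) \<and>
        (\<forall>j. y j \<in> E) \<and>
        summable (\<lambda>j. c j * P p (y j)) \<and>
        (\<forall>x\<in>E. (\<lambda>N. P p (\<lambda>n. x n - (\<Sum>j<N. f j x * y j n))) \<longlonglongrightarrow> 0))"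

definition series_sums_on ::
    "(nat \<Rightarrow> 'a::{real_normed_field,banach}) set \<Rightarrow> (nat \<Rightarrow> (nat \<Rightarrow> 'a) \<Rightarrow> real)
      \<Rightarrow> (nat \<Rightarrow> nat \<Rightarrow> 'a) \<Rightarrow> (nat \<Rightarrow> 'a) \<Rightarrow> bool" where
  "series_sums_on E P s y \<longleftrightarrow>
     y \<in> E \<and> (\<forall>k\<ge>1. (\<lambda>N. P k (\<lambda>i. y i - (\<Sum>n<N. s n i))) \<longlonglongrightarrow> 0)"

subsection \<open>Power series spaces of infinite type\<close>

definition psi_space :: "(nat \<Rightarrow> real) \<Rightarrow> (nat \<Rightarrow> 'a::{real_normed_field,banach}) set" where
  "psi_space \<alpha> = {x. \<forall>k\<ge>1. summable (\<lambda>n. norm (x n) * exp (real k * \<alpha> n))}"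

definition psi_norm ::
    "(nat \<Rightarrow> real) \<Rightarrow> nat \<Rightarrow> (nat \<Rightarrow> 'a::{real_normed_field,banach}) \<Rightarrow> real" where
  "psi_norm \<alpha> k x = (\<Sum>n. norm (x n) * exp (real k * \<alpha> n))"

text \<open>The dual space, with a functional identified with its values on the canonical basis.\<close>

definition psi_dual :: "(nat \<Rightarrow> real) \<Rightarrow> (nat \<Rightarrow> 'a::{real_normed_field,banach}) set" where
  "psi_dual \<alpha> = {\<beta>. \<exists>m\<ge>1. \<exists>C>0. \<forall>n. norm (\<beta> n) \<le> C * exp (real m * \<alpha> n)}"

definition unit_seq :: "nat \<Rightarrow> nat \<Rightarrow> 'a::{real_normed_field,banach}" where
  "unit_seq j = (\<lambda>i. if i = j then 1 else 0)"

subsection \<open>Convolution and the dual convolution operator\<close>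

definition conv ::
    "(nat \<Rightarrow> 'a::{real_normed_field,banach}) \<Rightarrow> (nat \<Rightarrow> 'a) \<Rightarrow> (nat \<Rightarrow> 'a)" where
  "conv \<beta> \<psi> = (\<lambda>m. \<Sum>i\<le>m. \<beta> i * \<psi> (m - i))"

text \<open>\<open>unit_seq 0\<close> is the neutral element of convolution.\<close>

primrec conv_power ::
    "(nat \<Rightarrow> 'a::{real_normed_field,banach}) \<Rightarrow> nat \<Rightarrow> (nat \<Rightarrow> 'a)" where
  "conv_power \<beta> 0 = unit_seq 0"
| "conv_power \<beta> (Suc k) = conv \<beta> (conv_power \<beta> k)"

definition dual_conv_basis ::
    "(nat \<Rightarrow> 'a::{real_normed_field,banach}) \<Rightarrow> nat \<Rightarrow> (nat \<Rightarrow> 'a)" where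
  "dual_conv_basis \<beta> n = (\<lambda>i. \<Sum>j\<le>n. \<beta> (n - j) * unit_seq j i)"

text \<open>The limit of the series \<open>\<Sum>\<^sub>n x\<^sub>n T e\<^sub>n\<close> in the space; it is unique because the seminorms are
  norms, and it exists for \<open>\<beta>\<close> in the dual if the space is nuclear.\<close>

definition dual_conv_op ::
    "(nat \<Rightarrow> real) \<Rightarrow> (nat \<Rightarrow> 'a::{real_normed_field,banach}) \<Rightarrow> (nat \<Rightarrow> 'a) \<Rightarrow> (nat \<Rightarrow> 'a)" where
  "dual_conv_op \<alpha> \<beta> x =
     (THE y. series_sums_on (psi_space \<alpha>) (psi_norm \<alpha>) (\<lambda>n i. x n * dual_conv_basis \<beta> n i) y)"

end

theory Submission
  imports Defs
begin

text \<open>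
  Write \<open>T\<close> for the dual convolution operator. It is the upper triangular Toeplitz matrix with
  entries \<open>\<beta> (n - i)\<close>, and products of such matrices correspond to convolutions of their
  symbols. Hence \<open>T\<^sup>k\<close> is the Toeplitz matrix of the convolution power \<open>\<beta>\<^sup>*\<^sup>k\<close>
  (\<open>dual_conv_op_funpow\<close>), and everything reduces to comparing the norms of a Toeplitz matrix
  with the growth of its symbol.

  If \<open>T\<close> is topologizable, the estimate for \<open>T\<^sup>k\<close> applied to the \<open>n\<close>-th basis vector bounds the
  norm of the \<open>n\<close>-th column of \<open>T\<^sup>k\<close>, whose top entry is \<open>\<beta>\<^sup>*\<^sup>k n\<close>.

  Conversely, let the symbol \<open>\<gamma>\<close> satisfy \<open>\<bar>\<gamma> n\<bar> \<le> L exp (m \<alpha> n)\<close>. Because \<open>\<alpha>\<close> is increasing, each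
  of the \<open>n + 1\<close> entries of the \<open>n\<close>-th column contributes at most \<open>L exp ((p + m) \<alpha> n)\<close> to its
  \<open>p\<close>-th norm. Nuclearity absorbs the number of entries: it yields \<open>n + 1 \<le> C exp (r \<alpha> n)\<close> for
  some \<open>C\<close> and \<open>r\<close> (\<open>nuclear_on_psi_space_imp_growth\<close>). So the matrix is bounded from the norm
  with index \<open>p + m + r\<close> to that with index \<open>p\<close> (\<open>toeplitz_bound\<close>). For \<open>\<gamma> = \<beta>\<^sup>*\<^sup>k\<close> this index
  does not depend on \<open>k\<close> if \<open>m\<close> does not, which is what topologizability asks for.
\<close>

section \<open>Norms and coordinates in power series spaces\<close>

lemma psi_space_summable:
  "x \<in> psi_space \<alpha> \<Longrightarrow> k \<ge> 1 \<Longrightarrow> summable (\<lambda>n. norm (x n) * exp (real k * \<alpha> n))"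
  by (simp add: psi_space_def)

lemma psi_norm_nonneg: "x \<in> psi_space \<alpha> \<Longrightarrow> k \<ge> 1 \<Longrightarrow> 0 \<le> psi_norm \<alpha> k x"
  unfolding psi_norm_def by (intro suminf_nonneg psi_space_summable) auto

lemma sum_le_psi_norm:
  assumes "x \<in> psi_space \<alpha>" "k \<ge> 1" "finite A"
  shows "(\<Sum>n\<in>A. norm (x n) * exp (real k * \<alpha> n)) \<le> psi_norm \<alpha> k x"
  unfolding psi_norm_def
  using assms by (intro sum_le_suminf psi_space_summable) auto

lemma coordinate_le_psi_norm:
  assumes "x \<in> psi_space \<alpha>" "k \<ge> 1" and "\<And>n. 0 \<le> \<alpha> n"
  shows "norm (x n) \<le> psi_norm \<alpha> k x"
proof -
  have "norm (x n) * 1 \<le> norm (x n) * exp (real k * \<alpha> n)"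
    by (intro mult_left_mono) (use assms in auto)
  also have "\<dots> \<le> psi_norm \<alpha> k x"
    using sum_le_psi_norm[OF assms(1,2), of "{n}"] by simp
  finally show ?thesis by simp
qed

lemma psi_space_scale:
  assumes "x \<in> psi_space \<alpha>" shows "(\<lambda>n. c * x n) \<in> psi_space \<alpha>"
  using assms by (auto simp: psi_space_def norm_mult mult.assoc intro: summable_mult)

lemma psi_space_add:
  assumes "x \<in> psi_space \<alpha>" "y \<in> psi_space \<alpha>"
  shows "(\<lambda>n. x n + y n) \<in> psi_space \<alpha>"
  unfolding psi_space_def
proof (intro CollectI allI impI)
  fix k :: nat assume k: "k \<ge> 1"
  show "summable (\<lambda>n. norm (x n + y n) * exp (real k * \<alpha> n))"
  proof (rule summable_comparison_test')
    show "summable (\<lambda>n. norm (x n) * exp (real k * \<alpha> n) + norm (y n) * exp (real k * \<alpha> n))"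
      using assms k by (intro summable_add psi_space_summable)
    show "norm (norm (x n + y n) * exp (real k * \<alpha> n))
        \<le> norm (x n) * exp (real k * \<alpha> n) + norm (y n) * exp (real k * \<alpha> n)" for n
      by (auto simp: distrib_right[symmetric] norm_triangle_ineq intro!: mult_right_mono)
  qed
qed

lemma psi_space_diff:
  assumes "x \<in> psi_space \<alpha>" "y \<in> psi_space \<alpha>"
  shows "(\<lambda>n. x n - y n) \<in> psi_space \<alpha>"
  using psi_space_add[OF assms(1) psi_space_scale[OF assms(2), of "-1"]] by simp

lemma psi_space_zero: "(\<lambda>n. 0) \<in> psi_space \<alpha>"
  by (simp add: psi_space_def)

lemma psi_space_sum:
  "(\<And>j. j \<in> A \<Longrightarrow> s j \<in> psi_space \<alpha>) \<Longrightarrow> (\<lambda>n. \<Sum>j\<in>A. s j n) \<in> psi_space \<alpha>"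
proof (induction A rule: infinite_finite_induct)
  case (insert a A)
  then show ?case by (simp add: psi_space_add)
qed (auto simp: psi_space_zero)

lemma finite_support_in_psi_space:
  assumes "\<And>n. n > N \<Longrightarrow> x n = 0"
  shows "x \<in> psi_space \<alpha>"
  unfolding psi_space_def
  by (intro CollectI allI impI summable_finite[of "{..N}"]) (use assms in auto)

lemma unit_seq_in_psi_space: "unit_seq j \<in> psi_space \<alpha>"
  by (rule finite_support_in_psi_space[of j]) (simp add: unit_seq_def)

lemma psi_norm_unit_seq:
  "psi_norm \<alpha> k (unit_seq j :: nat \<Rightarrow> 'a::{real_normed_field,banach}) = exp (real k * \<alpha> j)"
proof -
  have "psi_norm \<alpha> k (unit_seq j :: nat \<Rightarrow> 'a)
      = (\<Sum>n\<in>{j}. norm (unit_seq j n :: 'a) * exp (real k * \<alpha> n))"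
    unfolding psi_norm_def by (rule suminf_finite) (auto simp: unit_seq_def)
  then show ?thesis by (simp add: unit_seq_def)
qed

text \<open>Coordinates are continuous, so a series in the space can only converge to its
  coordinatewise sum. This makes the limit of such a series unique.\<close>

lemma psi_norm_convergence_imp_sums:
  assumes y: "y \<in> psi_space \<alpha>" and s: "\<And>n. s n \<in> psi_space \<alpha>" and "\<And>n. 0 \<le> \<alpha> n"
    and k: "k \<ge> 1" and lim: "(\<lambda>N. psi_norm \<alpha> k (\<lambda>i. y i - (\<Sum>n<N. s n i))) \<longlonglongrightarrow> 0"
  shows "(\<lambda>n. s n i) sums y i"
proof -
  have "(\<lambda>N. y i - (\<Sum>n<N. s n i)) \<longlonglongrightarrow> 0"
  proof (rule tendsto_0_le[OF lim, where K = 1])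
    show "\<forall>\<^sub>F N in sequentially. norm (y i - (\<Sum>n<N. s n i))
        \<le> norm (psi_norm \<alpha> k (\<lambda>i. y i - (\<Sum>n<N. s n i))) * 1"
    proof (intro always_eventually allI)
      fix N
      have "norm (y i - (\<Sum>n<N. s n i)) \<le> psi_norm \<alpha> k (\<lambda>i. y i - (\<Sum>n<N. s n i))"
        by (rule coordinate_le_psi_norm[OF psi_space_diff[OF y psi_space_sum[OF s]] k assms(3)])
      then show "norm (y i - (\<Sum>n<N. s n i))
          \<le> norm (psi_norm \<alpha> k (\<lambda>i. y i - (\<Sum>n<N. s n i))) * 1"
        by simp
    qed
  qed
  from tendsto_diff[OF tendsto_const this, of "y i"] show ?thesis
    by (simp add: sums_def)
qed

section \<open>Nuclearity forces exponential growth\<close>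

text \<open>A trace argument. Expanding the \<open>n\<close>-th basis vector by the nuclear representation and
  reading off its own coordinate gives \<open>1 = (\<Sum>j. f j (unit_seq n) * y j n)\<close>, where
  \<open>\<bar>f j (unit_seq n)\<bar> \<le> c j * exp (q \<alpha> n)\<close>. Hence \<open>exp (- q \<alpha> n)\<close> is at most the \<open>n\<close>-th
  coordinate of \<open>\<Sum>j. c j * \<bar>y j\<bar>\<close>, and the sum of these numbers over \<open>n\<close> is bounded by the sum
  of the \<open>c j * psi_norm \<alpha> 1 (y j)\<close>. As \<open>\<alpha>\<close> is increasing, the first \<open>N + 1\<close> of them are all at
  least \<open>exp (- q \<alpha> N)\<close>.\<close>

lemma nuclear_on_psi_space_imp_growth:
  assumes nonneg: "\<And>n. 0 \<le> \<alpha> n" and "mono \<alpha>"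
    and nuc: "nuclear_on (psi_space \<alpha> :: (nat \<Rightarrow> 'a::{real_normed_field,banach}) set) (psi_norm \<alpha>)"
  shows "\<exists>C r. \<forall>n. real (Suc n) \<le> C * exp (real r * \<alpha> n)"
proof -
  from nuc[unfolded nuclear_on_def, rule_format, of 1]
  obtain q :: nat and f :: "nat \<Rightarrow> (nat \<Rightarrow> 'a) \<Rightarrow> 'a" and c :: "nat \<Rightarrow> real" and y :: "nat \<Rightarrow> nat \<Rightarrow> 'a"
    where "\<forall>j. 0 \<le> c j \<and> (\<forall>x\<in>psi_space \<alpha>. norm (f j x) \<le> c j * psi_norm \<alpha> q x)"
      and "\<forall>j. y j \<in> psi_space \<alpha>"
      and sm: "summable (\<lambda>j. c j * psi_norm \<alpha> 1 (y j))"
      and "\<forall>x\<in>psi_space \<alpha>.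
         (\<lambda>N. psi_norm \<alpha> 1 (\<lambda>n. x n - (\<Sum>j<N. f j x * y j n))) \<longlonglongrightarrow> 0"
    by blast
  then have c: "0 \<le> c j" and y: "y j \<in> psi_space \<alpha>"
    and f: "x \<in> psi_space \<alpha> \<Longrightarrow> norm (f j x) \<le> c j * psi_norm \<alpha> q x"
    and lim: "x \<in> psi_space \<alpha> \<Longrightarrow>
      (\<lambda>N. psi_norm \<alpha> 1 (\<lambda>n. x n - (\<Sum>j<N. f j x * y j n))) \<longlonglongrightarrow> 0" for j x
    by blast+
  let ?S = "\<Sum>j. c j * psi_norm \<alpha> 1 (y j)"
  have sm_coord: "summable (\<lambda>j. c j * norm (y j n))" for n
    by (rule summable_comparison_test'[OF sm])
      (use c coordinate_le_psi_norm[OF y _ nonneg] in \<open>auto intro!: mult_left_mono\<close>)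
  have trace: "exp (- real q * \<alpha> n) \<le> (\<Sum>j. c j * norm (y j n))" for n
  proof -
    let ?u = "unit_seq n :: nat \<Rightarrow> 'a"
    have "(\<lambda>j. f j ?u * y j n) sums ?u n"
      by (rule psi_norm_convergence_imp_sums[OF _ _ nonneg _ lim])
        (auto intro: unit_seq_in_psi_space psi_space_scale y)
    then have one: "(\<Sum>j. f j ?u * y j n) = 1"
      by (simp add: sums_iff unit_seq_def)
    have le: "norm (f j ?u * y j n) \<le> exp (real q * \<alpha> n) * (c j * norm (y j n))" for j
      using mult_right_mono[OF f[OF unit_seq_in_psi_space[of n], of j], of "norm (y j n)"]
      by (simp add: norm_mult psi_norm_unit_seq mult_ac)
    have "norm (\<Sum>j. f j ?u * y j n) \<le> (\<Sum>j. exp (real q * \<alpha> n) * (c j * norm (y j n)))"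
      by (rule norm_suminf_le[OF le summable_mult[OF sm_coord]])
    also have "\<dots> = exp (real q * \<alpha> n) * (\<Sum>j. c j * norm (y j n))"
      by (rule suminf_mult[OF sm_coord])
    finally have "1 \<le> exp (real q * \<alpha> n) * (\<Sum>j. c j * norm (y j n))"
      unfolding one by simp
    then show ?thesis
      by (simp add: exp_minus field_simps)
  qed
  have "real (Suc N) \<le> ?S * exp (real q * \<alpha> N)" for N
  proof -
    have "real (Suc N) * exp (- real q * \<alpha> N) = (\<Sum>n\<le>N. exp (- real q * \<alpha> N))"
      by simp
    also have "\<dots> \<le> (\<Sum>n\<le>N. \<Sum>j. c j * norm (y j n))"
    proof (rule sum_mono)
      fix n assume "n \<in> {..N}"
      then have "\<alpha> n \<le> \<alpha> N" using \<open>mono \<alpha>\<close> by (simp add: monoD)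
      then have "exp (- real q * \<alpha> N) \<le> exp (- real q * \<alpha> n)"
        by (simp add: mult_left_mono)
      with trace[of n] show "exp (- real q * \<alpha> N) \<le> (\<Sum>j. c j * norm (y j n))"
        by linarith
    qed
    also have "\<dots> = (\<Sum>j. \<Sum>n\<le>N. c j * norm (y j n))"
      by (rule suminf_sum[symmetric]) (rule sm_coord)
    also have "\<dots> \<le> ?S"
    proof (rule suminf_le[OF _ _ sm])
      show "summable (\<lambda>j. \<Sum>n\<le>N. c j * norm (y j n))"
        by (rule summable_sum) (rule sm_coord)
      fix j
      have "(\<Sum>n\<le>N. norm (y j n)) \<le> (\<Sum>n\<le>N. norm (y j n) * exp (real 1 * \<alpha> n))"
        using nonneg by (intro sum_mono mult_le_cancel_left1[THEN iffD2]) auto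
      also have "\<dots> \<le> psi_norm \<alpha> 1 (y j)"
        by (rule sum_le_psi_norm[OF y]) auto
      finally show "(\<Sum>n\<le>N. c j * norm (y j n)) \<le> c j * psi_norm \<alpha> 1 (y j)"
        using c[of j] by (simp add: sum_distrib_left[symmetric] mult_left_mono)
    qed
    finally show ?thesis
      by (simp add: exp_minus field_simps)
  qed
  then show ?thesis by blast
qed

section \<open>Toeplitz matrices on power series spaces\<close>

lemma dual_conv_basis_apply: "dual_conv_basis \<gamma> n i = (if i \<le> n then \<gamma> (n - i) else 0)"
  by (simp add: dual_conv_basis_def unit_seq_def if_distrib[of "\<lambda>z. _ * z"] cong: if_cong)

lemma dual_conv_basis_in_psi_space: "dual_conv_basis \<gamma> n \<in> psi_space \<alpha>"
  by (rule finite_support_in_psi_space[of n]) (simp add: dual_conv_basis_apply)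

lemma dual_conv_basis_unit_seq: "dual_conv_basis (unit_seq 0) n = unit_seq n"
  by (auto simp: fun_eq_iff dual_conv_basis_apply unit_seq_def)

definition toeplitz ::
    "(nat \<Rightarrow> 'a::{real_normed_field,banach}) \<Rightarrow> (nat \<Rightarrow> 'a) \<Rightarrow> (nat \<Rightarrow> 'a)" where
  "toeplitz \<gamma> x = (\<lambda>i. \<Sum>n. x n * dual_conv_basis \<gamma> n i)"

lemma toeplitz_unit_seq: "toeplitz \<gamma> (unit_seq n) = dual_conv_basis \<gamma> n"
proof
  fix i
  have "toeplitz \<gamma> (unit_seq n) i = (\<Sum>m\<in>{n}. unit_seq n m * dual_conv_basis \<gamma> m i)"
    unfolding toeplitz_def by (rule suminf_finite) (auto simp: unit_seq_def)
  then show "toeplitz \<gamma> (unit_seq n) i = dual_conv_basis \<gamma> n i"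
    by (simp add: unit_seq_def)
qed

text \<open>Toeplitz matrices multiply by convolving their symbols. On a single column this is an
  identity between finite sums.\<close>

lemma toeplitz_dual_conv_basis:
  "toeplitz \<beta> (dual_conv_basis \<gamma> n) = dual_conv_basis (conv \<beta> \<gamma>) n"
proof
  fix i
  have "toeplitz \<beta> (dual_conv_basis \<gamma> n) i
      = (\<Sum>m\<in>{i..n}. dual_conv_basis \<gamma> n m * dual_conv_basis \<beta> m i)"
    unfolding toeplitz_def by (rule suminf_finite) (auto simp: dual_conv_basis_apply)
  also have "\<dots> = (\<Sum>m\<in>{i..n}. \<beta> (m - i) * \<gamma> (n - m))"
    by (rule sum.cong) (auto simp: dual_conv_basis_apply)
  also have "\<dots> = dual_conv_basis (conv \<beta> \<gamma>) n i"
  proof (cases "i \<le> n")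
    case True
    have "(\<Sum>m\<in>{i..n}. \<beta> (m - i) * \<gamma> (n - m)) = (\<Sum>l\<le>n - i. \<beta> l * \<gamma> (n - i - l))"
      by (rule sum.reindex_bij_witness[of _ "\<lambda>l. l + i" "\<lambda>m. m - i"]) (use True in auto)
    then show ?thesis using True by (simp add: dual_conv_basis_apply conv_def)
  qed (simp add: dual_conv_basis_apply)
  finally show "toeplitz \<beta> (dual_conv_basis \<gamma> n) i = dual_conv_basis (conv \<beta> \<gamma>) n i" .
qed

text \<open>The growth condition is what nuclearity provides: columns with \<open>n + 1\<close> entries cost no
  more than a shift of the index of the norm.\<close>

locale growing_exponents =
  fixes \<alpha> :: "nat \<Rightarrow> real" and C :: real and r :: nat
  assumes nonneg: "0 \<le> \<alpha> n" and mono: "mono \<alpha>"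
    and growth: "real (Suc n) \<le> C * exp (real r * \<alpha> n)"
begin

lemma C_pos: "0 < C"
proof -
  have "0 < C * exp (real r * \<alpha> 0)" using growth[of 0] by simp
  then show ?thesis by (simp add: zero_less_mult_iff)
qed

lemma column_bound:
  assumes \<gamma>: "\<And>n. norm (\<gamma> n) \<le> L * exp (real m * \<alpha> n)"
  shows "(\<Sum>i<J. norm (dual_conv_basis \<gamma> n i) * exp (real p * \<alpha> i))
     \<le> L * C * exp (real (p + m + r) * \<alpha> n)"
proof -
  have L: "0 \<le> L"
    using order_trans[OF norm_ge_zero \<gamma>[of 0]] by (simp add: zero_le_mult_iff)
  have "(\<Sum>i<J. norm (dual_conv_basis \<gamma> n i) * exp (real p * \<alpha> i))
      = (\<Sum>i\<in>{..<J} \<inter> {..n}. norm (\<gamma> (n - i)) * exp (real p * \<alpha> i))"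
    by (rule sum.mono_neutral_cong_right) (auto simp: dual_conv_basis_apply)
  also have "\<dots> \<le> (\<Sum>i\<le>n. norm (\<gamma> (n - i)) * exp (real p * \<alpha> i))"
    by (rule sum_mono2) auto
  also have "\<dots> \<le> (\<Sum>i\<le>n. L * exp (real m * \<alpha> n) * exp (real p * \<alpha> n))"
  proof (intro sum_mono mult_mono)
    fix i assume "i \<in> {..n}"
    then have le: "\<alpha> i \<le> \<alpha> n" "\<alpha> (n - i) \<le> \<alpha> n" using mono by (auto simp: monoD)
    show "exp (real p * \<alpha> i) \<le> exp (real p * \<alpha> n)"
      using le by (simp add: mult_left_mono)
    have "L * exp (real m * \<alpha> (n - i)) \<le> L * exp (real m * \<alpha> n)"
      using le L by (simp add: mult_left_mono)
    with \<gamma>[of "n - i"] show "norm (\<gamma> (n - i)) \<le> L * exp (real m * \<alpha> n)" by linarith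
  qed (use L in auto)
  also have "\<dots> = real (Suc n) * (L * exp (real m * \<alpha> n) * exp (real p * \<alpha> n))"
    by simp
  also have "\<dots> \<le> C * exp (real r * \<alpha> n) * (L * exp (real m * \<alpha> n) * exp (real p * \<alpha> n))"
    by (rule mult_right_mono[OF growth]) (use L in auto)
  also have "\<dots> = L * C * exp (real (p + m + r) * \<alpha> n)"
    by (simp add: distrib_right exp_add)
  finally show ?thesis .
qed

lemma toeplitz_row_summable:
  assumes \<gamma>: "\<And>n. norm (\<gamma> n) \<le> L * exp (real m * \<alpha> n)" and x: "x \<in> psi_space \<alpha>"
  shows "summable (\<lambda>n. norm (x n * dual_conv_basis \<gamma> n i))"
proof (rule summable_comparison_test')
  show "summable (\<lambda>n. L * C * (norm (x n) * exp (real (1 + m + r) * \<alpha> n)))"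
    by (intro summable_mult psi_space_summable[OF x]) simp
  fix n
  have "norm (dual_conv_basis \<gamma> n i) * 1 \<le> norm (dual_conv_basis \<gamma> n i) * exp (real 1 * \<alpha> i)"
    using nonneg by (intro mult_left_mono) auto
  also have "\<dots> \<le> (\<Sum>i<Suc i. norm (dual_conv_basis \<gamma> n i) * exp (real 1 * \<alpha> i))"
    by (simp add: sum_nonneg)
  also have "\<dots> \<le> L * C * exp (real (1 + m + r) * \<alpha> n)"
    by (rule column_bound[OF \<gamma>])
  finally have "norm (x n) * norm (dual_conv_basis \<gamma> n i)
      \<le> norm (x n) * (L * C * exp (real (1 + m + r) * \<alpha> n))"
    by (intro mult_left_mono) auto
  then show "norm (norm (x n * dual_conv_basis \<gamma> n i))
      \<le> L * C * (norm (x n) * exp (real (1 + m + r) * \<alpha> n))"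
    by (simp add: norm_mult mult_ac)
qed

lemmas toeplitz_row_summable' = summable_norm_cancel[OF toeplitz_row_summable]

text \<open>The order of summation is exchanged only between finitely many rows and all columns, after
  which \<open>column_bound\<close> applies to each column. The bound does not depend on the number of rows, so
  it gives both membership in the space and the estimate of the norm.\<close>

lemma toeplitz_partial_bound:
  assumes \<gamma>: "\<And>n. norm (\<gamma> n) \<le> L * exp (real m * \<alpha> n)" and x: "x \<in> psi_space \<alpha>"
    and p: "p \<ge> 1"
  shows "(\<Sum>i<J. norm (toeplitz \<gamma> x i) * exp (real p * \<alpha> i))
    \<le> L * C * psi_norm \<alpha> (p + m + r) x"
proof -
  note row = toeplitz_row_summable[OF \<gamma> x]
  have "(\<Sum>i<J. norm (toeplitz \<gamma> x i) * exp (real p * \<alpha> i))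
      \<le> (\<Sum>i<J. \<Sum>n. norm (x n * dual_conv_basis \<gamma> n i) * exp (real p * \<alpha> i))"
  proof (rule sum_mono)
    fix i
    have "norm (toeplitz \<gamma> x i) \<le> (\<Sum>n. norm (x n * dual_conv_basis \<gamma> n i))"
      unfolding toeplitz_def by (rule summable_norm[OF row])
    then show "norm (toeplitz \<gamma> x i) * exp (real p * \<alpha> i)
        \<le> (\<Sum>n. norm (x n * dual_conv_basis \<gamma> n i) * exp (real p * \<alpha> i))"
      by (simp add: suminf_mult2[OF row, symmetric])
  qed
  also have "\<dots> = (\<Sum>n. \<Sum>i<J. norm (x n * dual_conv_basis \<gamma> n i) * exp (real p * \<alpha> i))"
    by (intro suminf_sum[symmetric] summable_mult2 row)
  also have "\<dots> \<le> (\<Sum>n. L * C * (norm (x n) * exp (real (p + m + r) * \<alpha> n)))"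
  proof (rule suminf_le)
    fix n
    have "(\<Sum>i<J. norm (x n * dual_conv_basis \<gamma> n i) * exp (real p * \<alpha> i))
        = norm (x n) * (\<Sum>i<J. norm (dual_conv_basis \<gamma> n i) * exp (real p * \<alpha> i))"
      by (simp add: sum_distrib_left norm_mult mult.assoc)
    also have "\<dots> \<le> norm (x n) * (L * C * exp (real (p + m + r) * \<alpha> n))"
      by (intro mult_left_mono column_bound[OF \<gamma>]) auto
    finally show "(\<Sum>i<J. norm (x n * dual_conv_basis \<gamma> n i) * exp (real p * \<alpha> i))
        \<le> L * C * (norm (x n) * exp (real (p + m + r) * \<alpha> n))"
      by (simp add: mult_ac)
  next
    show "summable (\<lambda>n. \<Sum>i<J. norm (x n * dual_conv_basis \<gamma> n i) * exp (real p * \<alpha> i))"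
      by (intro summable_sum summable_mult2 row)
  next
    show "summable (\<lambda>n. L * C * (norm (x n) * exp (real (p + m + r) * \<alpha> n)))"
      using p by (intro summable_mult psi_space_summable[OF x]) simp
  qed
  also have "\<dots> = L * C * psi_norm \<alpha> (p + m + r) x"
    unfolding psi_norm_def
    using p by (intro suminf_mult psi_space_summable[OF x]) simp
  finally show ?thesis .
qed

lemma toeplitz_in_psi_space:
  assumes \<gamma>: "\<And>n. norm (\<gamma> n) \<le> L * exp (real m * \<alpha> n)" and x: "x \<in> psi_space \<alpha>"
  shows "toeplitz \<gamma> x \<in> psi_space \<alpha>"
  unfolding psi_space_def
  by (intro CollectI allI impI summableI_nonneg_bounded[OF _ toeplitz_partial_bound[OF \<gamma> x]]) auto

lemma toeplitz_bound:
  assumes \<gamma>: "\<And>n. norm (\<gamma> n) \<le> L * exp (real m * \<alpha> n)" and x: "x \<in> psi_space \<alpha>"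
    and p: "p \<ge> 1"
  shows "psi_norm \<alpha> p (toeplitz \<gamma> x) \<le> L * C * psi_norm \<alpha> (p + m + r) x"
proof -
  have "psi_norm \<alpha> p (toeplitz \<gamma> x) = (\<Sum>i. norm (toeplitz \<gamma> x i) * exp (real p * \<alpha> i))"
    by (simp add: psi_norm_def)
  also have "\<dots> \<le> L * C * psi_norm \<alpha> (p + m + r) x"
    by (intro suminf_le_const psi_space_summable toeplitz_in_psi_space[OF \<gamma> x] p
        toeplitz_partial_bound[OF \<gamma> x p])
  finally show ?thesis .
qed

lemma toeplitz_add:
  assumes \<gamma>: "\<And>n. norm (\<gamma> n) \<le> L * exp (real m * \<alpha> n)"
    and x: "x \<in> psi_space \<alpha>" and y: "y \<in> psi_space \<alpha>"
  shows "toeplitz \<gamma> (\<lambda>n. x n + y n) = (\<lambda>n. toeplitz \<gamma> x n + toeplitz \<gamma> y n)"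
  unfolding toeplitz_def
  using suminf_add[OF toeplitz_row_summable'[OF \<gamma> x] toeplitz_row_summable'[OF \<gamma> y]]
  by (simp add: distrib_right)

lemma toeplitz_scale:
  assumes \<gamma>: "\<And>n. norm (\<gamma> n) \<le> L * exp (real m * \<alpha> n)" and x: "x \<in> psi_space \<alpha>"
  shows "toeplitz \<gamma> (\<lambda>n. c * x n) = (\<lambda>n. c * toeplitz \<gamma> x n)"
  unfolding toeplitz_def
  using suminf_mult[OF toeplitz_row_summable'[OF \<gamma> x]] by (simp add: mult.assoc)

lemma toeplitz_diff:
  assumes \<gamma>: "\<And>n. norm (\<gamma> n) \<le> L * exp (real m * \<alpha> n)"
    and x: "x \<in> psi_space \<alpha>" and y: "y \<in> psi_space \<alpha>"
  shows "toeplitz \<gamma> (\<lambda>n. x n - y n) = (\<lambda>n. toeplitz \<gamma> x n - toeplitz \<gamma> y n)"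
  unfolding toeplitz_def
  using suminf_diff[OF toeplitz_row_summable'[OF \<gamma> x] toeplitz_row_summable'[OF \<gamma> y]]
  by (simp add: left_diff_distrib)

lemma toeplitz_sum:
  assumes \<gamma>: "\<And>n. norm (\<gamma> n) \<le> L * exp (real m * \<alpha> n)"
    and s: "\<And>j. s j \<in> psi_space \<alpha>"
  shows "toeplitz \<gamma> (\<lambda>n. \<Sum>j\<in>A. s j n) = (\<lambda>n. \<Sum>j\<in>A. toeplitz \<gamma> (s j) n)"
proof (induction A rule: infinite_finite_induct)
  case (insert a A)
  then show ?case
    using toeplitz_add[OF \<gamma> s[of a] psi_space_sum[of A s, OF s]] by simp
qed (simp_all add: toeplitz_def)

text \<open>Linearity and \<open>toeplitz_bound\<close> turn the remainder of the series into the image of a remainder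
  that tends to zero.\<close>

lemma series_sums_on_toeplitz:
  assumes \<gamma>: "\<And>n. norm (\<gamma> n) \<le> L * exp (real m * \<alpha> n)"
    and s: "\<And>j. s j \<in> psi_space \<alpha>"
    and sums: "series_sums_on (psi_space \<alpha>) (psi_norm \<alpha>) s y"
  shows "series_sums_on (psi_space \<alpha>) (psi_norm \<alpha>) (\<lambda>j. toeplitz \<gamma> (s j)) (toeplitz \<gamma> y)"
  unfolding series_sums_on_def
proof (intro conjI allI impI)
  have y: "y \<in> psi_space \<alpha>"
    and lim: "\<And>k. k \<ge> 1 \<Longrightarrow> (\<lambda>N. psi_norm \<alpha> k (\<lambda>i. y i - (\<Sum>n<N. s n i))) \<longlonglongrightarrow> 0"
    using sums by (auto simp: series_sums_on_def)
  show "toeplitz \<gamma> y \<in> psi_space \<alpha>" by (rule toeplitz_in_psi_space[OF \<gamma> y])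
  fix k :: nat assume k: "k \<ge> 1"
  let ?d = "\<lambda>N i. y i - (\<Sum>n<N. s n i)"
  have d: "?d N \<in> psi_space \<alpha>" for N by (intro psi_space_diff psi_space_sum y s)
  have eq: "(\<lambda>i. toeplitz \<gamma> y i - (\<Sum>n<N. toeplitz \<gamma> (s n) i)) = toeplitz \<gamma> (?d N)" for N
    by (simp add: toeplitz_diff[OF \<gamma> y psi_space_sum[OF s]] toeplitz_sum[OF \<gamma> s])
  have "(\<lambda>N. psi_norm \<alpha> k (toeplitz \<gamma> (?d N))) \<longlonglongrightarrow> 0"
  proof (rule tendsto_sandwich[OF _ _ tendsto_const])
    show "(\<lambda>N. L * C * psi_norm \<alpha> (k + m + r) (?d N)) \<longlonglongrightarrow> 0"
      by (rule tendsto_mult_right_zero[OF lim]) (use k in simp)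
    show "\<forall>\<^sub>F N in sequentially. 0 \<le> psi_norm \<alpha> k (toeplitz \<gamma> (?d N))"
      by (intro always_eventually allI psi_norm_nonneg toeplitz_in_psi_space[OF \<gamma> d] k)
    show "\<forall>\<^sub>F N in sequentially.
        psi_norm \<alpha> k (toeplitz \<gamma> (?d N)) \<le> L * C * psi_norm \<alpha> (k + m + r) (?d N)"
      by (intro always_eventually allI toeplitz_bound[OF \<gamma> d k])
  qed
  then show "(\<lambda>N. psi_norm \<alpha> k (\<lambda>i. toeplitz \<gamma> y i - (\<Sum>n<N. toeplitz \<gamma> (s n) i))) \<longlonglongrightarrow> 0"
    by (simp add: eq)
qed

lemma series_sums_on_unit_seq:
  assumes x: "x \<in> psi_space \<alpha>"
  shows "series_sums_on (psi_space \<alpha>) (psi_norm \<alpha>) (\<lambda>n i. x n * unit_seq n i) x"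
  unfolding series_sums_on_def
proof (intro conjI allI impI x)
  fix k :: nat assume k: "k \<ge> 1"
  let ?g = "\<lambda>n. norm (x n) * exp (real k * \<alpha> n)"
  note sm = psi_space_summable[OF x k]
  have tail: "psi_norm \<alpha> k (\<lambda>i. x i - (\<Sum>n<N. x n * unit_seq n i)) = psi_norm \<alpha> k x - sum ?g {..<N}"
    for N
  proof -
    have "x i - (\<Sum>n<N. x n * unit_seq n i) = (if i < N then 0 else x i)" for i
      by (simp add: unit_seq_def if_distrib[of "\<lambda>z. _ * z"] cong: if_cong)
    then have "psi_norm \<alpha> k (\<lambda>i. x i - (\<Sum>n<N. x n * unit_seq n i))
        = (\<Sum>i. if i < N then 0 else ?g i)"
      unfolding psi_norm_def by (intro suminf_cong) simp
    also have "\<dots> = (\<Sum>i. if i + N < N then 0 else ?g (i + N)) + (\<Sum>i<N. if i < N then 0 else ?g i)"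
    proof (rule suminf_split_initial_segment)
      show "summable (\<lambda>i. if i < N then 0 else ?g i)"
        by (rule summable_comparison_test'[OF sm]) auto
    qed
    also have "\<dots> = (\<Sum>i. ?g (i + N))" by simp
    also have "\<dots> = psi_norm \<alpha> k x - sum ?g {..<N}"
      using suminf_minus_initial_segment[OF sm, of N] by (simp add: psi_norm_def)
    finally show ?thesis .
  qed
  have "(\<lambda>N. psi_norm \<alpha> k x - sum ?g {..<N}) \<longlonglongrightarrow> psi_norm \<alpha> k x - psi_norm \<alpha> k x"
    unfolding psi_norm_def by (intro tendsto_diff tendsto_const summable_LIMSEQ sm)
  then show "(\<lambda>N. psi_norm \<alpha> k (\<lambda>i. x i - (\<Sum>n<N. x n * unit_seq n i))) \<longlonglongrightarrow> 0"
    by (simp add: tail)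
qed

lemma series_sums_on_columns_unique:
  assumes "series_sums_on (psi_space \<alpha>) (psi_norm \<alpha>) (\<lambda>n i. x n * dual_conv_basis \<gamma> n i) y"
  shows "y = toeplitz \<gamma> x"
proof
  fix i
  have "(\<lambda>n. x n * dual_conv_basis \<gamma> n i) sums y i"
    using assms
    by (intro psi_norm_convergence_imp_sums[OF _ _ nonneg, where k = 1])
      (auto simp: series_sums_on_def intro: psi_space_scale dual_conv_basis_in_psi_space)
  then show "y i = toeplitz \<gamma> x i" by (simp add: toeplitz_def sums_iff)
qed

lemma dual_conv_op_eq_toeplitz:
  assumes \<gamma>: "\<And>n. norm (\<gamma> n) \<le> L * exp (real m * \<alpha> n)" and x: "x \<in> psi_space \<alpha>"
  shows "dual_conv_op \<alpha> \<gamma> x = toeplitz \<gamma> x"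
  unfolding dual_conv_op_def
proof (rule the_equality[OF _ series_sums_on_columns_unique])
  show "series_sums_on (psi_space \<alpha>) (psi_norm \<alpha>) (\<lambda>n i. x n * dual_conv_basis \<gamma> n i)
      (toeplitz \<gamma> x)"
    using series_sums_on_toeplitz[OF \<gamma> psi_space_scale[OF unit_seq_in_psi_space]
        series_sums_on_unit_seq[OF x]]
    by (simp add: toeplitz_scale[OF \<gamma> unit_seq_in_psi_space] toeplitz_unit_seq)
qed

text \<open>Applying the continuous operator to the column expansion of the \<open>k\<close>-th iterate multiplies
  every column by the matrix, so that convergence of the expansion carries over from \<open>k\<close> to
  \<open>k + 1\<close>. Convergence in the space then identifies the iterate with the matrix of
  \<open>conv_power \<beta> k\<close>; multiplying two infinite matrices directly would require rearranging a double
  series.\<close>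

lemma dual_conv_op_funpow:
  assumes \<beta>: "\<And>n. norm (\<beta> n) \<le> L * exp (real m * \<alpha> n)" and x: "x \<in> psi_space \<alpha>"
  shows "(dual_conv_op \<alpha> \<beta> ^^ k) x = toeplitz (conv_power \<beta> k) x"
proof (rule series_sums_on_columns_unique)
  let ?sums = "series_sums_on (psi_space \<alpha>) (psi_norm \<alpha>)"
  show "?sums (\<lambda>n i. x n * dual_conv_basis (conv_power \<beta> k) n i) ((dual_conv_op \<alpha> \<beta> ^^ k) x)"
  proof (induction k)
    case 0
    show ?case using series_sums_on_unit_seq[OF x] by (simp add: dual_conv_basis_unit_seq)
  next
    case (Suc k)
    let ?y = "(dual_conv_op \<alpha> \<beta> ^^ k) x"
    have "?y \<in> psi_space \<alpha>" using Suc by (simp add: series_sums_on_def)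
    then have "(dual_conv_op \<alpha> \<beta> ^^ Suc k) x = toeplitz \<beta> ?y"
      by (simp add: dual_conv_op_eq_toeplitz[OF \<beta>])
    with series_sums_on_toeplitz[OF \<beta> psi_space_scale[OF dual_conv_basis_in_psi_space] Suc]
    show ?case
      by (simp add: toeplitz_scale[OF \<beta> dual_conv_basis_in_psi_space] toeplitz_dual_conv_basis)
  qed
qed

lemma linear_operator_on_dual_conv_op:
  fixes \<beta> :: "nat \<Rightarrow> 'a::{real_normed_field,banach}"
  assumes \<beta>: "\<And>n. norm (\<beta> n) \<le> L * exp (real m * \<alpha> n)"
  shows "linear_operator_on (psi_space \<alpha>) (dual_conv_op \<alpha> \<beta>)"
  unfolding linear_operator_on_def
  by (simp add: dual_conv_op_eq_toeplitz[OF \<beta>] psi_space_add psi_space_scale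
      toeplitz_in_psi_space[OF \<beta>] toeplitz_add[OF \<beta>] toeplitz_scale[OF \<beta>])

lemma continuous_operator_on_dual_conv_op:
  fixes \<beta> :: "nat \<Rightarrow> 'a::{real_normed_field,banach}"
  assumes \<beta>: "\<And>n. norm (\<beta> n) \<le> L * exp (real m * \<alpha> n)" and L: "0 < L"
  shows "continuous_operator_on (psi_space \<alpha>) (psi_norm \<alpha>) (dual_conv_op \<alpha> \<beta>)"
  unfolding continuous_operator_on_def
proof (intro ballI allI impI)
  fix x :: "nat \<Rightarrow> 'a" and p :: nat and \<epsilon> :: real
  assume x: "x \<in> psi_space \<alpha>" and p: "p \<ge> 1" and \<epsilon>: "\<epsilon> > 0"
  show "\<exists>q\<ge>1. \<exists>d>0. \<forall>y\<in>psi_space \<alpha>. psi_norm \<alpha> q (\<lambda>n. y n - x n) < d \<longrightarrow>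
      psi_norm \<alpha> p (\<lambda>n. dual_conv_op \<alpha> \<beta> y n - dual_conv_op \<alpha> \<beta> x n) < \<epsilon>"
  proof (intro exI[of _ "p + m + r"] exI[of _ "\<epsilon> / (L * C)"] conjI ballI impI)
    fix y :: "nat \<Rightarrow> 'a"
    assume y: "y \<in> psi_space \<alpha>" and d: "psi_norm \<alpha> (p + m + r) (\<lambda>n. y n - x n) < \<epsilon> / (L * C)"
    have "psi_norm \<alpha> p (\<lambda>n. dual_conv_op \<alpha> \<beta> y n - dual_conv_op \<alpha> \<beta> x n)
        = psi_norm \<alpha> p (toeplitz \<beta> (\<lambda>n. y n - x n))"
      by (simp add: dual_conv_op_eq_toeplitz[OF \<beta>] x y toeplitz_diff[OF \<beta>])
    also have "\<dots> \<le> L * C * psi_norm \<alpha> (p + m + r) (\<lambda>n. y n - x n)"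
      by (rule toeplitz_bound[OF \<beta> psi_space_diff[OF y x] p])
    also have "\<dots> < \<epsilon>"
      using d L C_pos by (simp add: pos_less_divide_eq mult.commute)
    finally show "psi_norm \<alpha> p (\<lambda>n. dual_conv_op \<alpha> \<beta> y n - dual_conv_op \<alpha> \<beta> x n) < \<epsilon>" .
  qed (use p \<epsilon> L C_pos in auto)
qed

end

section \<open>Topologizable dual convolution operators\<close>

theorem theorem5p1:
  fixes \<alpha> :: "nat \<Rightarrow> real" and \<beta> :: "nat \<Rightarrow> 'a::{real_normed_field,banach}"
  assumes "\<And>n. 0 \<le> \<alpha> n"
    and "mono \<alpha>"
    and "filterlim \<alpha> at_top sequentially"
    and "nuclear_on (psi_space \<alpha> :: (nat \<Rightarrow> 'a) set) (psi_norm \<alpha>)"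
    and "\<beta> \<in> psi_dual \<alpha>"
  shows "topologizable_on (psi_space \<alpha>) (psi_norm \<alpha>) (dual_conv_op \<alpha> \<beta>) \<longleftrightarrow>
    (\<forall>p::nat\<ge>1. \<exists>q::nat\<ge>1. \<forall>k::nat\<ge>1. \<exists>L>0. \<forall>n.
       norm (conv_power \<beta> k n) \<le> L * exp (real q * \<alpha> n))"
proof -
  obtain C r where "\<And>n. real (Suc n) \<le> C * exp (real r * \<alpha> n)"
    using nuclear_on_psi_space_imp_growth[OF assms(1,2,4)] by blast
  then interpret growing_exponents \<alpha> C r
    using assms(1,2) by unfold_locales
  obtain B m where B: "B > 0" and \<beta>: "\<And>n. norm (\<beta> n) \<le> B * exp (real m * \<alpha> n)"
    using assms(5) by (auto simp: psi_dual_def)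
  let ?T = "dual_conv_op \<alpha> \<beta>"
  show ?thesis
  proof (intro iffI allI impI)
    fix p :: nat assume p: "p \<ge> 1"
    assume "topologizable_on (psi_space \<alpha>) (psi_norm \<alpha>) ?T"
    then obtain q where q: "q \<ge> 1"
      and M: "\<And>k. k \<ge> 1 \<Longrightarrow> \<exists>M>0. \<forall>x\<in>psi_space \<alpha>. psi_norm \<alpha> p ((?T ^^ k) x) \<le> M * psi_norm \<alpha> q x"
      using p by (fastforce simp: topologizable_on_def)
    show "\<exists>q\<ge>1. \<forall>k\<ge>1. \<exists>L>0. \<forall>n. norm (conv_power \<beta> k n) \<le> L * exp (real q * \<alpha> n)"
    proof (intro exI[of _ q] conjI allI impI q)
      fix k :: nat assume "k \<ge> 1"
      from M[OF this] obtain M where M: "M > 0"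
        "\<And>x. x \<in> psi_space \<alpha> \<Longrightarrow> psi_norm \<alpha> p ((?T ^^ k) x) \<le> M * psi_norm \<alpha> q x" by blast
      have "norm (conv_power \<beta> k n) \<le> M * exp (real q * \<alpha> n)" for n
      proof -
        have "norm (conv_power \<beta> k n) = norm (dual_conv_basis (conv_power \<beta> k) n 0)"
          by (simp add: dual_conv_basis_apply)
        also have "\<dots> \<le> psi_norm \<alpha> p (dual_conv_basis (conv_power \<beta> k) n)"
          by (rule coordinate_le_psi_norm[OF dual_conv_basis_in_psi_space p nonneg])
        also have "\<dots> = psi_norm \<alpha> p ((?T ^^ k) (unit_seq n))"
          by (simp add: dual_conv_op_funpow[OF \<beta> unit_seq_in_psi_space] toeplitz_unit_seq)
        also have "\<dots> \<le> M * psi_norm \<alpha> q (unit_seq n :: nat \<Rightarrow> 'a)"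
          by (rule M(2)[OF unit_seq_in_psi_space])
        finally show ?thesis by (simp add: psi_norm_unit_seq)
      qed
      with M(1) show "\<exists>L>0. \<forall>n. norm (conv_power \<beta> k n) \<le> L * exp (real q * \<alpha> n)" by blast
    qed
  next
    assume growth: "\<forall>p::nat\<ge>1. \<exists>q::nat\<ge>1. \<forall>k::nat\<ge>1. \<exists>L>0. \<forall>n.
       norm (conv_power \<beta> k n) \<le> L * exp (real q * \<alpha> n)"
    have "\<exists>q\<ge>1. \<forall>k\<ge>1. \<exists>M>0. \<forall>x\<in>psi_space \<alpha>. psi_norm \<alpha> p ((?T ^^ k) x) \<le> M * psi_norm \<alpha> q x"
      if p: "p \<ge> 1" for p
    proof -
      obtain s where s: "\<And>k. k \<ge> 1 \<Longrightarrow>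
          \<exists>L>0. \<forall>n. norm (conv_power \<beta> k n) \<le> L * exp (real s * \<alpha> n)"
        using growth p by blast
      show ?thesis
      proof (intro exI[of _ "p + s + r"] conjI allI impI)
        fix k :: nat assume "k \<ge> 1"
        from s[OF this] obtain L
          where L: "L > 0" and bd: "\<And>n. norm (conv_power \<beta> k n) \<le> L * exp (real s * \<alpha> n)" by blast
        show "\<exists>M>0. \<forall>x\<in>psi_space \<alpha>. psi_norm \<alpha> p ((?T ^^ k) x) \<le> M * psi_norm \<alpha> (p + s + r) x"
          by (intro exI[of _ "L * C"] conjI ballI)
            (use L C_pos toeplitz_bound[OF bd _ p] in \<open>auto simp: dual_conv_op_funpow[OF \<beta>]\<close>)
      qed (use p in simp)
    qed
    then show "topologizable_on (psi_space \<alpha>) (psi_norm \<alpha>) ?T"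
      unfolding topologizable_on_def
      using linear_operator_on_dual_conv_op[OF \<beta>] continuous_operator_on_dual_conv_op[OF \<beta> B]
      by blast
  qed
qed

end
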